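(* Let $D$ be a cylindric diagram, $\nu=(\nu_1,\dots,\nu_n)$ a sequence of non-negative integers, and $k\ge1$ an integer. Then $$|\mathrm{CSSYT}(kD,k\nu)|>0\iff|\mathrm{CSSYT}(D,\nu)|>0 .$$
   Context: Fix integers $x,y\ge 1$. $\mathfrak{C}_{x,y}$ is the lattice $\mathbb{Z}^2$ modulo translation by $(x,-y)$; boxes of $\mathfrak{C}_{x,y}$ are unit boxes $(i,j)$ (column $i$, row $j$, rows counted upwards) modulo this translation. A boundary loop is the image in $\mathfrak{C}_{x,y}$ of an infinite lattice path with unit steps right and down that is invariant under translation by $(x,-y)$. A cylindric diagram $D$ on $\mathfrak{C}_{x,y}$ is a pair of boundary loops $(B_I,B_O)$ with $B_I$ weakly left/below $B_O$; it is identified with the finite set of boxes between them. A cylindric semistandard Young tableau of shape $D$ is a filling of the boxes of $D$ with positive integers which weakly increases when moving from a box to the box of $D$ immediately to its right and strictly increases when moving to the box of $D$ immediately above it (adjacency on the cylinder). $\mathrm{CSSYT}(D,\nu)$ is the set of those with weight $\nu$, i.e. with exactly $\nu_i$ entries equal to $i$ for $1\le i\le n$ and no other entries. For a positive integer $k$, $kD$ is the cylindric diagram on $\mathfrak{C}_{kx,y}$ obtained from $D$ by subdividing every box horizontally into $k$ boxes (i.e. every right step of both boundary loops is replaced by $k$ right steps); $k\nu=(k\nu_1,\dots,k\nu_n)$. *)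

theory Defs
  imports "HOL-Library.FuncSet"
begin

text \<open>
  A boundary loop is represented by the vertex set of its lift to the plane, a subset of
  \<open>\<int> \<times> \<int>\<close> invariant under translation by \<open>(x, -y)\<close>. This set determines the path: its steps are
  the pairs of horizontally or vertically adjacent vertices.
\<close>

definition lattice_path :: "(int \<Rightarrow> int \<times> int) \<Rightarrow> bool" where
  "lattice_path p \<longleftrightarrow>
     (\<forall>t. p (t + 1) = (fst (p t) + 1, snd (p t)) \<or> p (t + 1) = (fst (p t), snd (p t) - 1))"

definition boundary_loop :: "int \<Rightarrow> int \<Rightarrow> (int \<times> int) set \<Rightarrow> bool" where
  "boundary_loop x y B \<longleftrightarrow>
     (\<exists>p. lattice_path p \<and> B = range p) \<and> (\<lambda>(a, b). (a + x, b - y)) ` B = B"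

definition weakly_left_below :: "(int \<times> int) set \<Rightarrow> (int \<times> int) set \<Rightarrow> bool" where
  "weakly_left_below B B' \<longleftrightarrow> (\<forall>(a, b) \<in> B. \<exists>(a', b') \<in> B'. a \<le> a' \<and> b \<le> b')"

type_synonym diagram = "(int \<times> int) set \<times> (int \<times> int) set"

definition cylindric_diagram :: "int \<Rightarrow> int \<Rightarrow> diagram \<Rightarrow> bool" where
  "cylindric_diagram x y D \<longleftrightarrow>
     (case D of (B\<^sub>I, B\<^sub>O) \<Rightarrow>
        boundary_loop x y B\<^sub>I \<and> boundary_loop x y B\<^sub>O \<and> weakly_left_below B\<^sub>I B\<^sub>O)"

text \<open>
  The box \<open>(i, j)\<close> is the unit square with lower left corner \<open>(i, j)\<close> and upper right corner
  \<open>(i + 1, j + 1)\<close>. As loops only step right and down, a box lies to the right of and above a loop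
  iff its lower left corner is weakly right of and above some vertex of the loop; symmetrically for
  the other side.
\<close>

definition plane_boxes :: "diagram \<Rightarrow> (int \<times> int) set" where
  "plane_boxes D =
     (case D of (B\<^sub>I, B\<^sub>O) \<Rightarrow>
        {(i, j). (\<exists>(a, b) \<in> B\<^sub>I. a \<le> i \<and> b \<le> j) \<and> (\<exists>(a, b) \<in> B\<^sub>O. i + 1 \<le> a \<and> j + 1 \<le> b)})"

definition cyl_rel :: "int \<Rightarrow> int \<Rightarrow> ((int \<times> int) \<times> (int \<times> int)) set" where
  "cyl_rel x y = {((i, j), (i', j')). \<exists>m. i' = i + m * x \<and> j' = j - m * y}"

definition cyl_box :: "int \<Rightarrow> int \<Rightarrow> int \<Rightarrow> int \<Rightarrow> (int \<times> int) set" where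
  "cyl_box x y i j = cyl_rel x y `` {(i, j)}"

definition boxes :: "int \<Rightarrow> int \<Rightarrow> diagram \<Rightarrow> (int \<times> int) set set" where
  "boxes x y D = plane_boxes D // cyl_rel x y"

text \<open>
  Fillings are extensional functions, so that each tableau is counted once.
\<close>

definition cylindric_ssyt :: "int \<Rightarrow> int \<Rightarrow> diagram \<Rightarrow> ((int \<times> int) set \<Rightarrow> nat) set" where
  "cylindric_ssyt x y D =
     {T \<in> boxes x y D \<rightarrow>\<^sub>E {1..}.
        (\<forall>i j. (i, j) \<in> plane_boxes D \<and> (i + 1, j) \<in> plane_boxes D \<longrightarrow>
           T (cyl_box x y i j) \<le> T (cyl_box x y (i + 1) j)) \<and>
        (\<forall>i j. (i, j) \<in> plane_boxes D \<and> (i, j + 1) \<in> plane_boxes D \<longrightarrow>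
           T (cyl_box x y i j) < T (cyl_box x y i (j + 1)))}"

text \<open>
  The weight \<open>\<nu> = (\<nu>\<^sub>1, \<dots>, \<nu>\<^sub>n)\<close> is a list; lists are indexed from \<open>0\<close>, so \<open>\<nu>\<^sub>i\<close> is \<open>\<nu> ! (i - 1)\<close>.
\<close>

definition CSSYT :: "int \<Rightarrow> int \<Rightarrow> diagram \<Rightarrow> nat list \<Rightarrow> ((int \<times> int) set \<Rightarrow> nat) set" where
  "CSSYT x y D \<nu> =
     {T \<in> cylindric_ssyt x y D.
        (\<forall>i \<in> {1..length \<nu>}. card {c \<in> boxes x y D. T c = i} = \<nu> ! (i - 1)) \<and>
        (\<forall>c \<in> boxes x y D. T c \<in> {1..length \<nu>})}"

text \<open>
  Each vertex \<open>(a, b)\<close> moves to \<open>(k * a, b)\<close>, and a right step from \<open>(a, b)\<close> to \<open>(a + 1, b)\<close>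
  contributes the \<open>k + 1\<close> vertices from \<open>(k * a, b)\<close> to \<open>(k * a + k, b)\<close>.
\<close>

definition stretch_loop :: "nat \<Rightarrow> (int \<times> int) set \<Rightarrow> (int \<times> int) set" where
  "stretch_loop k B =
     {(int k * a + r, b) | a b r.
        (a, b) \<in> B \<and> (r = 0 \<or> (a + 1, b) \<in> B \<and> 0 \<le> r \<and> r \<le> int k)}"

definition stretch_diagram :: "nat \<Rightarrow> diagram \<Rightarrow> diagram" where
  "stretch_diagram k D = (case D of (B\<^sub>I, B\<^sub>O) \<Rightarrow> (stretch_loop k B\<^sub>I, stretch_loop k B\<^sub>O))"

end

theory Submission
  imports Defs
begin

text \<open>
  A loop is encoded by its profile, the function sending a row \<open>j\<close> to the column in which the loop
  steps down across that row; profiles are weakly decreasing and satisfy \<open>c (j - y) = c j + x\<close>. Cutting a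
  tableau along its entries \<open>\<le> i\<close> turns it into a chain of profiles \<open>L 0 = \<alpha>, \<dots>, L n = \<beta>\<close>
  from the inner to the outer loop, and the tableau conditions become the interlacing inequalities
  \<open>L i j \<le> L (i + 1) j \<le> L i (j - 1)\<close>. The weight records the increments of the sizes \<open>s i\<close>, the sums
  of \<open>L i\<close> over one period. Stretching by \<open>k\<close> multiplies \<open>\<alpha>\<close>, \<open>\<beta>\<close> and the sizes by \<open>k\<close>, so one
  direction is multiplication of a chain by \<open>k\<close>. The converse asks for an integral chain where
  division by \<open>k\<close> only gives a rational one; it is found by describing which sizes occur.

  Two facts describe them. First, when \<open>L (i - 1)\<close> and \<open>L (i + 1)\<close> are fixed, the entries of \<open>L i\<close>
  range independently over intervals, and the lower and upper ends
  over one period add up to \<open>s (i - 1) + s (i + 1)\<close>. So \<open>s i\<close> may be replaced by its reflection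
  \<open>s (i - 1) + s (i + 1) - s i\<close>, and by anything in between (\<open>exchange_closed_chain_sizes\<close>). In terms
  of weights, two adjacent parts may be swapped, or brought closer together keeping their sum: this
  is the symmetry of cylindric Schur functions together with the convexity of their support.
  Secondly, the greedy chain \<open>min (\<alpha> (j - i)) (\<beta> j)\<close> bounds all chains from above
  (\<open>strip_chain_upper\<close>), is itself a chain as soon as there is one (\<open>greedy_strip_chain\<close>), and is
  multiplied by \<open>k\<close> when the loops are stretched.

  Hence the sizes of the greedy chain dominate every \<open>s\<close> for which \<open>k s\<close> occurs in the
  stretched problem. If \<open>s\<close> is concave, that is, the weight is weakly decreasing, then \<open>s\<close> is reached
  from the greedy sizes by exchanges that decrease one value by one (\<open>concave_minorant\<close>).
  Otherwise reflections sort the weight, and these can be carried out in both problems at once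
  (\<open>exchange_closed_transfer\<close>).
\<close>

section \<open>Sequences closed under exchange\<close>

text \<open>
  The sequences stand for partial sums of weights. Replacing \<open>s i\<close> by the other end of the interval
  swaps the increments of \<open>s\<close> before and after \<open>i\<close>; the values in between make these two increments
  more equal.
\<close>

definition exchange_closed :: "nat \<Rightarrow> ((nat \<Rightarrow> int) \<Rightarrow> bool) \<Rightarrow> bool" where
  "exchange_closed n P \<longleftrightarrow>
     (\<forall>s i v. P s \<longrightarrow> 0 < i \<longrightarrow> i < n \<longrightarrow>
        min (s i) (s (i - 1) + s (i + 1) - s i) \<le> v \<longrightarrow>
        v \<le> max (s i) (s (i - 1) + s (i + 1) - s i) \<longrightarrow> P (s(i := v)))"

lemma exchange_closedD:
  assumes "exchange_closed n P" "P s" "0 < i" "i < n"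
    and "min (s i) (s (i - 1) + s (i + 1) - s i) \<le> v"
    and "v \<le> max (s i) (s (i - 1) + s (i + 1) - s i)"
  shows "P (s(i := v))"
  using assms unfolding exchange_closed_def by blast

text \<open>
  Muirhead's argument on partial sums. At the first place \<open>m\<close> where \<open>s - \<sigma>\<close> is maximal, the
  difference \<open>s - \<sigma>\<close> rises strictly before \<open>m\<close> and does not rise after it, so concavity of \<open>\<sigma>\<close>
  makes \<open>s\<close> strictly concave at \<open>m\<close>. Therefore lowering \<open>s m\<close> by one is an exchange, and since the
  difference is positive there, the result still dominates \<open>\<sigma>\<close>.
\<close>

lemma concave_minorant:
  assumes closed: "exchange_closed n P"
    and concave: "\<And>i. 0 < i \<Longrightarrow> i < n \<Longrightarrow> \<sigma> (i - 1) + \<sigma> (i + 1) \<le> 2 * \<sigma> i"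
    and "P s" and "\<And>i. \<sigma> i \<le> s i" and "\<sigma> 0 = s 0" and "\<And>i. i \<ge> n \<Longrightarrow> \<sigma> i = s i"
  shows "P \<sigma>"
  using assms(3-)
proof (induction "nat (\<Sum>i<n. s i - \<sigma> i)" arbitrary: s rule: less_induct)
  case less
  show ?case
  proof (cases "s = \<sigma>")
    case True
    then show ?thesis using less.prems by simp
  next
    case False
    define M where "M = Max ((\<lambda>i. s i - \<sigma> i) ` {..n})"
    have M: "s i - \<sigma> i \<le> M" if "i \<le> n" for i
      using that unfolding M_def by (intro Max_ge) auto
    have "M \<in> (\<lambda>i. s i - \<sigma> i) ` {..n}"
      unfolding M_def by (intro Max_in) auto
    then have ex: "\<exists>i. i \<le> n \<and> s i - \<sigma> i = M" by auto
    define m where "m = (LEAST i. i \<le> n \<and> s i - \<sigma> i = M)"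
    have m: "m \<le> n" "s m - \<sigma> m = M"
      using LeastI_ex[OF ex] by (auto simp: m_def)
    have "M > 0"
    proof -
      obtain i where "s i \<noteq> \<sigma> i" using False by blast
      then have "s i - \<sigma> i > 0" "i < n"
        using less.prems(2)[of i] less.prems(4)[of i] by (auto simp: not_less[symmetric])
      then show ?thesis using M[of i] by simp
    qed
    then have "0 < m" "m < n"
      using m less.prems(3) less.prems(4)[of n] by (auto intro: Nat.gr0I le_neq_trans)
    have "s (m - 1) - \<sigma> (m - 1) < M"
    proof -
      have "s (m - 1) - \<sigma> (m - 1) \<noteq> M"
        using not_less_Least[of "m - 1" "\<lambda>i. i \<le> n \<and> s i - \<sigma> i = M"] \<open>0 < m\<close> m
        unfolding m_def[symmetric] by auto
      moreover have "m - 1 \<le> n" using m(1) by linarith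
      ultimately show ?thesis using M[of "m - 1"] by linarith
    qed
    moreover have "s (m + 1) - \<sigma> (m + 1) \<le> M" using M[of "m + 1"] \<open>m < n\<close> by simp
    ultimately have drop: "s (m - 1) + s (m + 1) - s m \<le> s m - 1"
      using concave[OF \<open>0 < m\<close> \<open>m < n\<close>] m by linarith
    define s' where "s' = s(m := s m - 1)"
    have "P s'"
      unfolding s'_def using drop \<open>0 < m\<close> \<open>m < n\<close> less.prems(1)
      by (intro exchange_closedD[OF closed]) auto
    moreover have le: "\<sigma> i \<le> s' i" for i
      using less.prems(2)[of i] m \<open>M > 0\<close> by (auto simp: s'_def)
    moreover have "\<sigma> 0 = s' 0" "\<And>i. i \<ge> n \<Longrightarrow> \<sigma> i = s' i"
      using less.prems(3,4) \<open>0 < m\<close> \<open>m < n\<close> by (auto simp: s'_def)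
    moreover have "nat (\<Sum>i<n. s' i - \<sigma> i) < nat (\<Sum>i<n. s i - \<sigma> i)"
    proof -
      have "(\<Sum>i<n. s' i - \<sigma> i) < (\<Sum>i<n. s i - \<sigma> i)"
        by (rule sum_strict_mono_ex1) (use \<open>m < n\<close> in \<open>auto simp: s'_def\<close>)
      moreover have "0 \<le> (\<Sum>i<n. s' i - \<sigma> i)" using le by (intro sum_nonneg) simp
      ultimately show ?thesis by linarith
    qed
    ultimately show ?thesis using less.hyps[of s'] by blast
  qed
qed

text \<open>
  At a place where \<open>s\<close> fails to be concave, its reflection is larger, and \<open>f\<close> bounds this growth.
  So finitely many reflections, which stay within \<open>Q\<close>, lead to a concave sequence. That one is below
  \<open>f\<close> and lies in \<open>P\<close>, and since reflections are involutions, \<open>P\<close> can follow them back.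
\<close>

lemma exchange_closed_transfer:
  assumes P: "exchange_closed n P" and Q: "exchange_closed n Q"
    and f: "P f"
    and dom: "\<And>s. Q s \<Longrightarrow> (\<forall>i. s i \<le> f i) \<and> s 0 = f 0 \<and> (\<forall>i\<ge>n. s i = f i)"
    and "Q s"
  shows "P s"
  using \<open>Q s\<close>
proof (induction "nat (\<Sum>i<n. f i - s i)" arbitrary: s rule: less_induct)
  case less
  show ?case
  proof (cases "\<forall>i. 0 < i \<longrightarrow> i < n \<longrightarrow> s (i - 1) + s (i + 1) \<le> 2 * s i")
    case True
    then show ?thesis
      using dom[OF less.prems] by (intro concave_minorant[OF P _ f]) auto
  next
    case False
    then obtain i where i: "0 < i" "i < n" "s (i - 1) + s (i + 1) > 2 * s i"
      by (auto simp: not_le)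
    define s' where "s' = s(i := s (i - 1) + s (i + 1) - s i)"
    have "Q s'"
      unfolding s'_def using i less.prems by (intro exchange_closedD[OF Q]) auto
    moreover have "nat (\<Sum>i<n. f i - s' i) < nat (\<Sum>i<n. f i - s i)"
    proof -
      have "(\<Sum>i<n. f i - s' i) < (\<Sum>i<n. f i - s i)"
        by (rule sum_strict_mono_ex1) (use i in \<open>auto simp: s'_def\<close>)
      moreover have "0 \<le> (\<Sum>i<n. f i - s' i)"
        using dom[OF \<open>Q s'\<close>] by (intro sum_nonneg) simp
      ultimately show ?thesis by linarith
    qed
    ultimately have "P s'" using less.hyps by blast
    then have "P (s'(i := s i))"
      using i by (intro exchange_closedD[OF P]) (auto simp: s'_def)
    then show ?thesis by (simp add: s'_def)
  qed
qed

section \<open>Quasi-periodic chains\<close>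

definition quasi_periodic :: "int \<Rightarrow> int \<Rightarrow> (int \<Rightarrow> int) \<Rightarrow> bool" where
  "quasi_periodic x y c \<longleftrightarrow> (\<forall>j. c (j - y) = c j + x)"

lemma quasi_periodic_shift:
  assumes "quasi_periodic x y c"
  shows "c (j - m * y) = c j + m * x"
proof (induction m rule: int_induct[where k = 0])
  case base
  then show ?case by simp
next
  case (step1 m)
  have "c (j - (m + 1) * y) = c (j - m * y - y)" by (simp add: algebra_simps)
  also have "\<dots> = c (j - m * y) + x" using assms by (simp only: quasi_periodic_def)
  finally show ?case using step1 by (simp add: algebra_simps)
next
  case (step2 m)
  have "c (j - m * y) = c (j - (m - 1) * y - y)" by (simp add: algebra_simps)
  also have "\<dots> = c (j - (m - 1) * y) + x" using assms by (simp only: quasi_periodic_def)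
  finally show ?case using step2 by (simp add: algebra_simps)
qed

lemma quasi_periodic_mod:
  assumes "quasi_periodic x y c"
  shows "c j = c (j mod y) - j div y * x"
  using quasi_periodic_shift[OF assms, of j "j div y"] by (simp add: minus_div_mult_eq_mod)

text \<open>
  Shifting the summation range by one row exchanges the values at \<open>y - 1\<close> and \<open>- 1\<close>, which differ
  by \<open>x\<close>.
\<close>

lemma sum_quasi_periodic_pred:
  assumes "quasi_periodic x y c" and "y \<ge> 1"
  shows "(\<Sum>j\<in>{0..<y}. c (j - 1)) = (\<Sum>j\<in>{0..<y}. c j) + x"
proof -
  have "(\<Sum>j\<in>{0..<y}. c (j - 1)) = (\<Sum>j\<in>{-1..<y - 1}. c j)"
    by (rule sum.reindex_bij_witness[of _ "\<lambda>j. j + 1" "\<lambda>j. j - 1"]) auto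
  also have "{-1..<y - 1} = insert (-1) {0..<y - 1}" using assms(2) by auto
  also have "(\<Sum>j\<in>insert (-1) {0..<y - 1}. c j) = c (-1) + (\<Sum>j\<in>{0..<y - 1}. c j)"
    by (subst sum.insert) auto
  also have "c (-1) = c (y - 1) + x"
    using quasi_periodic_shift[OF assms(1), of "y - 1" 1] by simp
  also have "c (y - 1) + x + (\<Sum>j\<in>{0..<y - 1}. c j) = (\<Sum>j\<in>insert (y - 1) {0..<y - 1}. c j) + x"
    by (subst sum.insert) auto
  also have "insert (y - 1) {0..<y - 1} = {0..<y}" using assms(2) by auto
  finally show ?thesis .
qed

text \<open>
  The profile \<open>L i\<close> bounds the boxes with entry at most \<open>i\<close>. The inequality
  \<open>L (Suc i) j \<le> L i (j - 1)\<close> says that a box with entry \<open>Suc i\<close> has a smaller entry or the inner loop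
  below it, so that consecutive profiles differ by a horizontal strip. The chain is continued
  constantly beyond \<open>n\<close>, so that the sequence of its sizes is determined as a function on all of \<open>nat\<close>.
\<close>

definition strip_chain ::
    "int \<Rightarrow> int \<Rightarrow> (int \<Rightarrow> int) \<Rightarrow> (int \<Rightarrow> int) \<Rightarrow> nat \<Rightarrow> (nat \<Rightarrow> int \<Rightarrow> int) \<Rightarrow> bool" where
  "strip_chain x y \<alpha> \<beta> n L \<longleftrightarrow>
     (\<forall>i. quasi_periodic x y (L i)) \<and> L 0 = \<alpha> \<and> (\<forall>i\<ge>n. L i = \<beta>) \<and>
     (\<forall>i j. L i j \<le> L (Suc i) j \<and> L (Suc i) j \<le> L i (j - 1))"

lemma strip_chain_mono:
  assumes "strip_chain x y \<alpha> \<beta> n L" and "i \<le> i'"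
  shows "L i j \<le> L i' j"
  using assms lift_Suc_mono_le[of "\<lambda>i. L i j" i i'] by (auto simp: strip_chain_def)

lemma strip_chain_upper:
  assumes "strip_chain x y \<alpha> \<beta> n L"
  shows "L i j \<le> \<alpha> (j - int i)"
proof (induction i arbitrary: j)
  case 0
  then show ?case using assms by (simp add: strip_chain_def)
next
  case (Suc i)
  have "L (Suc i) j \<le> L i (j - 1)" using assms by (simp add: strip_chain_def)
  also have "\<dots> \<le> \<alpha> (j - 1 - int i)" by (rule Suc)
  finally show ?case by (simp add: algebra_simps)
qed

definition chain_sizes ::
    "int \<Rightarrow> int \<Rightarrow> (int \<Rightarrow> int) \<Rightarrow> (int \<Rightarrow> int) \<Rightarrow> nat \<Rightarrow> (nat \<Rightarrow> int) \<Rightarrow> bool" where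
  "chain_sizes x y \<alpha> \<beta> n s \<longleftrightarrow>
     (\<exists>L. strip_chain x y \<alpha> \<beta> n L \<and> s = (\<lambda>i. \<Sum>j\<in>{0..<y}. L i j))"

text \<open>
  Discrete intermediate value property: the sums of integral points of a box fill the whole
  interval between the extreme sums.
\<close>

lemma ex_sum_between:
  fixes lo hi :: "'a \<Rightarrow> int"
  assumes "finite A" and "\<And>j. j \<in> A \<Longrightarrow> lo j \<le> hi j" and "sum lo A \<le> v" and "v \<le> sum hi A"
  shows "\<exists>b. (\<forall>j\<in>A. lo j \<le> b j \<and> b j \<le> hi j) \<and> sum b A = v"
  using assms
proof (induction A arbitrary: v rule: finite_induct)
  case empty
  then show ?case by simp
next
  case (insert a A)
  define u where "u = max (lo a) (v - sum hi A)"
  have "sum lo A \<le> sum hi A" using insert.prems(1) by (intro sum_mono) simp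
  then have u: "lo a \<le> u" "u \<le> hi a" "sum lo A \<le> v - u" "v - u \<le> sum hi A"
    using insert.prems insert.hyps by (auto simp: u_def)
  then obtain b where b: "\<forall>j\<in>A. lo j \<le> b j \<and> b j \<le> hi j" "sum b A = v - u"
    using insert.IH[of "v - u"] insert.prems(1) by auto
  have "sum (b(a := u)) A = sum b A" using insert.hyps by (intro sum.cong) auto
  then have "(\<forall>j\<in>insert a A. lo j \<le> (b(a := u)) j \<and> (b(a := u)) j \<le> hi j) \<and>
      sum (b(a := u)) (insert a A) = v"
    using b u insert.hyps by auto
  then show ?case by blast
qed

text \<open>
  Only \<open>L i\<close> is changed. The inequalities that involve it confine each \<open>L i j\<close> to an interval
  \<open>[lo j, hi j]\<close> depending on \<open>L (i - 1)\<close> and \<open>L (i + 1)\<close> alone, so the possible sums over a period form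
  an integer interval. Its ends add up to \<open>s (i - 1) + s (i + 1)\<close>, hence it is symmetric under the
  reflection and contains everything between \<open>s i\<close> and its mirror image.
\<close>

lemma exchange_closed_chain_sizes:
  assumes "y \<ge> 1"
  shows "exchange_closed n (chain_sizes x y \<alpha> \<beta> n)"
  unfolding exchange_closed_def
proof (intro allI impI)
  fix s i v
  assume "chain_sizes x y \<alpha> \<beta> n s" and i: "0 < i" "i < n"
    and v: "min (s i) (s (i - 1) + s (i + 1) - s i) \<le> v"
      "v \<le> max (s i) (s (i - 1) + s (i + 1) - s i)"
  then obtain L where L: "strip_chain x y \<alpha> \<beta> n L" and s: "s = (\<lambda>i. \<Sum>j\<in>{0..<y}. L i j)"
    unfolding chain_sizes_def by blast
  have per: "L i (j - y) = L i j + x" for i j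
    using L by (auto simp: strip_chain_def quasi_periodic_def)
  have step: "L i j \<le> L (Suc i) j" "L (Suc i) j \<le> L i (j - 1)" for i j
    using L by (auto simp: strip_chain_def)
  define lo where "lo = (\<lambda>j. max (L (i - 1) j) (L (i + 1) (j + 1)))"
  define hi where "hi = (\<lambda>j. min (L (i - 1) (j - 1)) (L (i + 1) j))"
  have bounds: "lo j \<le> L i j" "L i j \<le> hi j" for j
    using step[of "i - 1" j] step[of i j] step(2)[of i "j + 1"] i by (auto simp: lo_def hi_def)
  have lo_per: "quasi_periodic x y lo" and hi_per: "quasi_periodic x y hi"
    unfolding quasi_periodic_def lo_def hi_def
    using per[of "i - 1"] per[of "i + 1"] per[of "i + 1" "_ + 1"] per[of "i - 1" "_ - 1"]
    by (auto simp: algebra_simps)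
  \<comment> \<open>The upper end in a row and the lower end in the row below are the minimum and the
    maximum of the same two numbers, so they can be added row by row after a shift. Undoing the
    shift costs \<open>x\<close> on each side of the equation.\<close>
  have "(\<Sum>j\<in>{0..<y}. lo (j - 1)) + (\<Sum>j\<in>{0..<y}. hi j) =
      (\<Sum>j\<in>{0..<y}. L (i - 1) (j - 1)) + (\<Sum>j\<in>{0..<y}. L (i + 1) j)"
    unfolding sum.distrib[symmetric] by (intro sum.cong) (auto simp: lo_def hi_def)
  moreover have "quasi_periodic x y (L (i - 1))" using L by (simp add: strip_chain_def)
  ultimately have lohi: "sum lo {0..<y} + sum hi {0..<y} = s (i - 1) + s (i + 1)"
    using sum_quasi_periodic_pred[OF lo_per assms] sum_quasi_periodic_pred[OF _ assms]
    by (simp add: s)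
  have "sum lo {0..<y} \<le> s i" "s i \<le> sum hi {0..<y}"
    unfolding s by (intro sum_mono bounds)+
  then have "sum lo {0..<y} \<le> v" "v \<le> sum hi {0..<y}"
    using v lohi by (auto simp: min_def max_def split: if_splits)
  moreover have "lo j \<le> hi j" for j using bounds[of j] by simp
  ultimately obtain b where b: "\<forall>j\<in>{0..<y}. lo j \<le> b j \<and> b j \<le> hi j"
      and sum_b: "sum b {0..<y} = v"
    using ex_sum_between[of "{0..<y}" lo hi v] by blast
  \<comment> \<open>The values chosen in the rows of one period extend uniquely to a quasi-periodic function.\<close>
  define c where "c = (\<lambda>j. b (j mod y) - j div y * x)"
  have c_per: "quasi_periodic x y c"
  proof -
    have "(j - y) div y = j div y - 1" "(j - y) mod y = j mod y" for j
      using assms div_add_self2[of y "j - y"] by auto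
    then show ?thesis unfolding quasi_periodic_def c_def by (simp only:) (simp add: algebra_simps)
  qed
  have c: "lo j \<le> c j" "c j \<le> hi j" for j
    using bspec[OF b, of "j mod y"] assms quasi_periodic_mod[OF lo_per, of j] quasi_periodic_mod[OF hi_per, of j]
    by (auto simp: c_def)
  have sum_c: "sum c {0..<y} = v"
    unfolding sum_b[symmetric] by (intro sum.cong) (auto simp: c_def)
  define L' where "L' = L(i := c)"
  have "strip_chain x y \<alpha> \<beta> n L'"
    unfolding strip_chain_def
  proof (intro conjI allI impI)
    fix l j
    show "quasi_periodic x y (L' l)" using c_per L by (simp add: L'_def strip_chain_def)
    have "L (i - 1) j \<le> c j" "c j \<le> L (i - 1) (j - 1)" "c j \<le> L (i + 1) j"
        "L (i + 1) j \<le> c (j - 1)"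
      using c[of j] c(1)[of "j - 1"] by (auto simp: lo_def hi_def)
    moreover have "l = i - 1 \<longleftrightarrow> Suc l = i" using i by auto
    ultimately show "L' l j \<le> L' (Suc l) j" "L' (Suc l) j \<le> L' l (j - 1)"
      using step[of l j] by (auto simp: L'_def)
  qed (use i L in \<open>auto simp: L'_def strip_chain_def\<close>)
  moreover have "s(i := v) = (\<lambda>i. \<Sum>j\<in>{0..<y}. L' i j)"
    using sum_c by (auto simp: L'_def s)
  ultimately show "chain_sizes x y \<alpha> \<beta> n (s(i := v))"
    unfolding chain_sizes_def by blast
qed

text \<open>
  Each strip is taken as large as interlacing and the outer loop allow; the assumption \<open>reach\<close>
  says that \<open>n\<close> such strips fill the diagram.
\<close>

lemma greedy_strip_chain:
  assumes "quasi_periodic x y \<alpha>" "quasi_periodic x y \<beta>" "antimono \<alpha>" "antimono \<beta>"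
    and "\<And>j. \<alpha> j \<le> \<beta> j" and reach: "\<And>j. \<beta> j \<le> \<alpha> (j - int n)"
  shows "strip_chain x y \<alpha> \<beta> n (\<lambda>i j. min (\<alpha> (j - int i)) (\<beta> j))"
  unfolding strip_chain_def
proof (intro conjI allI impI)
  fix i :: nat
  have "\<alpha> (j - y - int i) = \<alpha> (j - int i) + x" for j
    using assms(1) by (metis quasi_periodic_def diff_right_commute)
  then show "quasi_periodic x y (\<lambda>j. min (\<alpha> (j - int i)) (\<beta> j))"
    using assms(2) by (auto simp: quasi_periodic_def)
next
  show "(\<lambda>j. min (\<alpha> (j - int 0)) (\<beta> j)) = \<alpha>" using assms(5) by (auto simp: min_def)
next
  fix i assume "n \<le> i"
  have "\<beta> j \<le> \<alpha> (j - int i)" for j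
    using reach[of j] antimonoD[OF assms(3), of "j - int i" "j - int n"] \<open>n \<le> i\<close> by simp
  then show "(\<lambda>j. min (\<alpha> (j - int i)) (\<beta> j)) = \<beta>" by (simp add: min_absorb2)
next
  fix i j
  show "min (\<alpha> (j - int i)) (\<beta> j) \<le> min (\<alpha> (j - int (Suc i))) (\<beta> j)"
    using antimonoD[OF assms(3), of "j - int (Suc i)" "j - int i"] by auto
  have shift: "j - int (Suc i) = j - 1 - int i" by simp
  show "min (\<alpha> (j - int (Suc i))) (\<beta> j) \<le> min (\<alpha> (j - 1 - int i)) (\<beta> (j - 1))"
    unfolding shift using antimonoD[OF assms(4), of "j - 1" j] by auto
qed

text \<open>
  The saturation property for chains. The upper bound \<open>min (\<alpha> (j - i)) (\<beta> j)\<close> on the \<open>i\<close>-th profile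
  is homogeneous in \<open>\<alpha>\<close> and \<open>\<beta>\<close>, so the bound in the stretched problem is \<open>k\<close> times the size of the
  integral greedy chain \<open>f\<close> of the original one. Closure under exchange, which both problems share,
  leads from \<open>f\<close> to \<open>s\<close>.
\<close>

lemma chain_sizes_scale:
  assumes qp: "quasi_periodic x y \<alpha>" "quasi_periodic x y \<beta>" and anti: "antimono \<alpha>" "antimono \<beta>"
    and le: "\<And>j. \<alpha> j \<le> \<beta> j" and "y \<ge> 1" and k: "k \<ge> 1"
  shows "chain_sizes (k * x) y (\<lambda>j. k * \<alpha> j) (\<lambda>j. k * \<beta> j) n (\<lambda>i. k * s i) \<longleftrightarrow>
         chain_sizes x y \<alpha> \<beta> n s"
proof
  assume "chain_sizes x y \<alpha> \<beta> n s"
  then obtain L where L: "strip_chain x y \<alpha> \<beta> n L" and s: "s = (\<lambda>i. \<Sum>j\<in>{0..<y}. L i j)"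
    unfolding chain_sizes_def by blast
  have "strip_chain (k * x) y (\<lambda>j. k * \<alpha> j) (\<lambda>j. k * \<beta> j) n (\<lambda>i j. k * L i j)"
    using L k by (auto simp: strip_chain_def quasi_periodic_def distrib_left)
  then show "chain_sizes (k * x) y (\<lambda>j. k * \<alpha> j) (\<lambda>j. k * \<beta> j) n (\<lambda>i. k * s i)"
    unfolding chain_sizes_def s by (auto simp: sum_distrib_left)
next
  \<comment> \<open>Scaling commutes with reflection, so the property \<open>Q\<close> inherits closure under exchange from
    the stretched problem.\<close>
  define Q where "Q = (\<lambda>s. chain_sizes (k * x) y (\<lambda>j. k * \<alpha> j) (\<lambda>j. k * \<beta> j) n (\<lambda>i. k * s i))"
  assume "chain_sizes (k * x) y (\<lambda>j. k * \<alpha> j) (\<lambda>j. k * \<beta> j) n (\<lambda>i. k * s i)"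
  then have "Q s" by (simp add: Q_def)
  have bound: "k * s i = (\<Sum>j\<in>{0..<y}. L i j)"
    if "(\<lambda>i. k * s i) = (\<lambda>i. \<Sum>j\<in>{0..<y}. L i j)" for s L and i :: nat
    using that by (rule fun_cong)
  have reach: "\<beta> j \<le> \<alpha> (j - int n)" for j
  proof -
    obtain L where L: "strip_chain (k * x) y (\<lambda>j. k * \<alpha> j) (\<lambda>j. k * \<beta> j) n L"
      using \<open>Q s\<close> unfolding Q_def chain_sizes_def by blast
    have "k * \<beta> j \<le> k * \<alpha> (j - int n)"
      using strip_chain_upper[OF L, of n j] L by (simp add: strip_chain_def)
    then show ?thesis using k by simp
  qed
  define f where "f = (\<lambda>i. \<Sum>j\<in>{0..<y}. min (\<alpha> (j - int i)) (\<beta> j))"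
  have "chain_sizes x y \<alpha> \<beta> n f"
    unfolding chain_sizes_def f_def using greedy_strip_chain[OF qp anti le reach] by blast
  moreover have "exchange_closed n Q"
    unfolding exchange_closed_def
  proof (intro allI impI)
    fix s i v
    assume "Q s" "0 < i" "i < n" and v: "min (s i) (s (i - 1) + s (i + 1) - s i) \<le> v"
      "v \<le> max (s i) (s (i - 1) + s (i + 1) - s i)"
    have scale: "k * s (i - 1) + k * s (i + 1) - k * s i = k * (s (i - 1) + s (i + 1) - s i)"
      by (simp add: algebra_simps)
    have "min (k * s i) (k * s (i - 1) + k * s (i + 1) - k * s i) \<le> k * v"
      "k * v \<le> max (k * s i) (k * s (i - 1) + k * s (i + 1) - k * s i)"
      unfolding scale using v k by (auto simp: min_le_iff_disj le_max_iff_disj)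
    then have "chain_sizes (k * x) y (\<lambda>j. k * \<alpha> j) (\<lambda>j. k * \<beta> j) n ((\<lambda>i. k * s i)(i := k * v))"
      using \<open>Q s\<close> \<open>0 < i\<close> \<open>i < n\<close> unfolding Q_def
      by (intro exchange_closedD[OF exchange_closed_chain_sizes[OF \<open>y \<ge> 1\<close>]]) auto
    moreover have "(\<lambda>i. k * s i)(i := k * v) = (\<lambda>l. k * (s(i := v)) l)" by auto
    ultimately show "Q (s(i := v))" by (simp add: Q_def)
  qed
  moreover have "(\<forall>i. s i \<le> f i) \<and> s 0 = f 0 \<and> (\<forall>i\<ge>n. s i = f i)" if "Q s" for s
  proof -
    obtain L where L: "strip_chain (k * x) y (\<lambda>j. k * \<alpha> j) (\<lambda>j. k * \<beta> j) n L"
      and s: "(\<lambda>i. k * s i) = (\<lambda>i. \<Sum>j\<in>{0..<y}. L i j)"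
      using \<open>Q s\<close> unfolding Q_def chain_sizes_def by blast
    have f_scaled: "k * f i = (\<Sum>j\<in>{0..<y}. k * min (\<alpha> (j - int i)) (\<beta> j))" for i
      by (simp add: f_def sum_distrib_left)
    have "k * s i \<le> k * f i" for i
      unfolding f_scaled bound[OF s]
    proof (rule sum_mono)
      fix j
      have "L i j \<le> L (max i n) j" by (rule strip_chain_mono[OF L]) simp
      then have "L i j \<le> k * \<beta> j" using L by (simp add: strip_chain_def)
      then show "L i j \<le> k * min (\<alpha> (j - int i)) (\<beta> j)"
        using strip_chain_upper[OF L, of i j] by (simp add: min_def)
    qed
    moreover have "k * s 0 = k * f 0"
      unfolding f_scaled bound[OF s]
      using L le by (intro sum.cong) (auto simp: strip_chain_def min_def)
    moreover have "k * s i = k * f i" if "i \<ge> n" for i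
    proof -
      have "\<beta> j \<le> \<alpha> (j - int i)" for j
        using reach[of j] antimonoD[OF anti(1), of "j - int i" "j - int n"] that by simp
      then show ?thesis
        unfolding f_scaled bound[OF s]
        using L that by (simp add: strip_chain_def min_absorb2)
    qed
    ultimately show ?thesis using k by auto
  qed
  ultimately show "chain_sizes x y \<alpha> \<beta> n s"
    using exchange_closed_transfer[OF exchange_closed_chain_sizes[OF \<open>y \<ge> 1\<close>]] \<open>Q s\<close> by blast
qed

section \<open>Tableaux as chains\<close>

lemma cyl_box_eq_iff:
  "cyl_box x y i j = cyl_box x y i' j' \<longleftrightarrow> (\<exists>m. i' = i + m * x \<and> j' = j - m * y)"
proof
  assume eq: "cyl_box x y i j = cyl_box x y i' j'"
  have "(i', j') \<in> cyl_box x y i' j'"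
    by (auto simp: cyl_box_def cyl_rel_def intro!: exI[of _ 0])
  then show "\<exists>m. i' = i + m * x \<and> j' = j - m * y"
    unfolding eq[symmetric] by (auto simp: cyl_box_def cyl_rel_def)
next
  assume "\<exists>m. i' = i + m * x \<and> j' = j - m * y"
  then obtain m where m: "i' = i + m * x" "j' = j - m * y" by blast
  have "(\<exists>l. a = i + l * x \<and> b = j - l * y) \<longleftrightarrow> (\<exists>l. a = i' + l * x \<and> b = j' - l * y)" for a b
  proof
    assume "\<exists>l. a = i + l * x \<and> b = j - l * y"
    then obtain l where "a = i + l * x" "b = j - l * y" by blast
    then have "a = i' + (l - m) * x \<and> b = j' - (l - m) * y" using m by (simp add: algebra_simps)
    then show "\<exists>l. a = i' + l * x \<and> b = j' - l * y" by blast
  next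
    assume "\<exists>l. a = i' + l * x \<and> b = j' - l * y"
    then obtain l where "a = i' + l * x" "b = j' - l * y" by blast
    then have "a = i + (l + m) * x \<and> b = j - (l + m) * y" using m by (simp add: algebra_simps)
    then show "\<exists>l. a = i + l * x \<and> b = j - l * y" by blast
  qed
  then show "cyl_box x y i j = cyl_box x y i' j'"
    by (auto simp: cyl_box_def cyl_rel_def)
qed

lemma boxes_eq: "boxes x y D = {cyl_box x y i j | i j. (i, j) \<in> plane_boxes D}"
  by (auto simp: boxes_def quotient_def cyl_box_def)

text \<open>
  Applied to a row, which increases weakly, with \<open>P\<close> stating that the entry is at most \<open>l\<close>: the
  threshold is the end of the initial segment of these entries. Its uniqueness is what makes the
  resulting profiles quasi-periodic.
\<close>

lemma ex1_threshold:
  fixes a b :: int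
  assumes "a \<le> b" and "\<And>c. a \<le> c \<Longrightarrow> c + 1 < b \<Longrightarrow> P (c + 1) \<Longrightarrow> P c"
  shows "\<exists>!m. a \<le> m \<and> m \<le> b \<and> (\<forall>c. a \<le> c \<longrightarrow> c < b \<longrightarrow> (P c \<longleftrightarrow> c < m))"
proof (rule ex_ex1I)
  show "\<exists>m. a \<le> m \<and> m \<le> b \<and> (\<forall>c. a \<le> c \<longrightarrow> c < b \<longrightarrow> (P c \<longleftrightarrow> c < m))"
    using assms
  proof (induction b rule: int_ge_induct)
    case base
    then show ?case by auto
  next
    case (step b)
    then obtain m where m: "a \<le> m" "m \<le> b" "\<And>c. a \<le> c \<Longrightarrow> c < b \<Longrightarrow> (P c \<longleftrightarrow> c < m)"
      by force
    show ?case
    proof (cases "P b")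
      case True
      have "m = b"
      proof (rule ccontr)
        assume "m \<noteq> b"
        then have "a \<le> b - 1" "m \<le> b - 1" using m(1,2) by auto
        then show False using m(3)[of "b - 1"] step.prems[of "b - 1"] True by simp
      qed
      then have "P c \<longleftrightarrow> c < b + 1" if "a \<le> c" "c < b + 1" for c
        using that True m(3)[of c] by (cases "c = b") auto
      then show ?thesis using step.hyps by (intro exI[of _ "b + 1"]) auto
    next
      case False
      then have "P c \<longleftrightarrow> c < m" if "a \<le> c" "c < b + 1" for c
        using that m(2) m(3)[of c] by (cases "c = b") auto
      then show ?thesis using m(1,2) by (intro exI[of _ m]) auto
    qed
  qed
next
  fix m m'
  assume m: "a \<le> m \<and> m \<le> b \<and> (\<forall>c. a \<le> c \<longrightarrow> c < b \<longrightarrow> (P c \<longleftrightarrow> c < m))"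
    and m': "a \<le> m' \<and> m' \<le> b \<and> (\<forall>c. a \<le> c \<longrightarrow> c < b \<longrightarrow> (P c \<longleftrightarrow> c < m'))"
  show "m = m'"
  proof (rule linorder_cases[of m m'])
    assume "m < m'" then show ?thesis using m m' by force
  next
    assume "m' < m" then show ?thesis using m m' by force
  qed
qed

text \<open>
  From here on a diagram enters only through the profiles of its two loops, which treats a diagram
  and its stretching uniformly.
\<close>

locale cylindric_shape =
  fixes x y :: int and D :: diagram and \<alpha> \<beta> :: "int \<Rightarrow> int"
  assumes y_pos: "y \<ge> 1"
    and qp_inner: "quasi_periodic x y \<alpha>" and qp_outer: "quasi_periodic x y \<beta>"
    and anti_inner: "antimono \<alpha>" and anti_outer: "antimono \<beta>"
    and inner_le_outer: "\<alpha> j \<le> \<beta> j"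
    and plane_boxes_iff: "(i, j) \<in> plane_boxes D \<longleftrightarrow> \<alpha> j \<le> i \<and> i < \<beta> j"
begin

lemma boxes_mem_iff: "cyl_box x y i j \<in> boxes x y D \<longleftrightarrow> (i, j) \<in> plane_boxes D"
proof
  assume "cyl_box x y i j \<in> boxes x y D"
  then obtain i' j' where box: "cyl_box x y i' j' = cyl_box x y i j" "(i', j') \<in> plane_boxes D"
    unfolding boxes_eq by auto
  then obtain m where m: "i = i' + m * x" "j = j' - m * y" unfolding cyl_box_eq_iff by blast
  show "(i, j) \<in> plane_boxes D"
    using box(2) unfolding m
    by (simp add: plane_boxes_iff quasi_periodic_shift[OF qp_inner] quasi_periodic_shift[OF qp_outer])
qed (auto simp: boxes_eq)

lemma boxes_cases:
  assumes "C \<in> boxes x y D"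
  obtains i j where "C = cyl_box x y i j" "j \<in> {0..<y}" "\<alpha> j \<le> i" "i < \<beta> j"
proof -
  obtain i j where C: "C = cyl_box x y i j" "(i, j) \<in> plane_boxes D"
    using assms unfolding boxes_eq by blast
  define m where "m = j div y"
  have C': "C = cyl_box x y (i + m * x) (j - m * y)" unfolding C(1) cyl_box_eq_iff by blast
  moreover have "(i + m * x, j - m * y) \<in> plane_boxes D"
    using assms unfolding C' boxes_mem_iff .
  moreover have "j - m * y \<in> {0..<y}"
    using y_pos by (simp add: m_def minus_div_mult_eq_mod)
  ultimately show thesis using that unfolding plane_boxes_iff by blast
qed

lemma finite_boxes: "finite (boxes x y D)"
proof (rule finite_subset)
  show "boxes x y D \<subseteq> (\<lambda>(j, i). cyl_box x y i j) ` (SIGMA j:{0..<y}. {\<alpha> j..<\<beta> j})"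
    by (auto elim!: boxes_cases simp: image_iff Bex_def)
qed simp

lemma finite_CSSYT: "finite (CSSYT x y D \<nu>)"
proof (rule finite_subset)
  show "CSSYT x y D \<nu> \<subseteq> boxes x y D \<rightarrow>\<^sub>E {1..length \<nu>}"
    unfolding CSSYT_def cylindric_ssyt_def PiE_def by blast
  show "finite (boxes x y D \<rightarrow>\<^sub>E {1..length \<nu>})"
    using finite_boxes by (intro finite_PiE) auto
qed

text \<open>
  In row \<open>j\<close> the entries equal to \<open>Suc l\<close> occupy the columns from \<open>L l j\<close> to before \<open>L (Suc l) j\<close>, and
  each box of the cylinder has exactly one representative in the rows \<open>0, \<dots>, y - 1\<close>.
\<close>

lemma card_entries:
  assumes L: "strip_chain x y \<alpha> \<beta> n L"
    and T: "\<And>i j l. (i, j) \<in> plane_boxes D \<Longrightarrow> T (cyl_box x y i j) \<le> l \<longleftrightarrow> i < L l j"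
  shows "int (card {C \<in> boxes x y D. T C = Suc l}) =
    (\<Sum>j\<in>{0..<y}. L (Suc l) j) - (\<Sum>j\<in>{0..<y}. L l j)"
proof -
  define R where "R = (SIGMA j:{0..<y}. {L l j..<L (Suc l) j})"
  have low: "\<alpha> j \<le> L l j" for l j
    using strip_chain_mono[OF L, of 0 l] L by (simp add: strip_chain_def)
  have high: "L l j \<le> \<beta> j" for l j
    using strip_chain_mono[OF L, of l "max l n" j] L by (simp add: strip_chain_def)
  have entry: "T (cyl_box x y i j) = Suc l \<longleftrightarrow> L l j \<le> i \<and> i < L (Suc l) j"
    if "(i, j) \<in> plane_boxes D" for i j
    using T[OF that, of l] T[OF that, of "Suc l"] by linarith
  have "bij_betw (\<lambda>(j, i). cyl_box x y i j) R {C \<in> boxes x y D. T C = Suc l}"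
  proof (rule bij_betw_imageI)
    show "inj_on (\<lambda>(j, i). cyl_box x y i j) R"
    proof (intro inj_onI, clarify)
      fix j i j' i'
      assume "(j, i) \<in> R" "(j', i') \<in> R" "cyl_box x y i j = cyl_box x y i' j'"
      then obtain m where m: "i' = i + m * x" "j' = j - m * y" "j \<in> {0..<y}" "j' \<in> {0..<y}"
        by (auto simp: cyl_box_eq_iff R_def)
      then have "\<bar>m * y\<bar> < y" by auto
      then have "\<bar>m\<bar> * y < 1 * y" using y_pos by (simp add: abs_mult)
      then have "m = 0" using y_pos mult_less_cancel_right[of "\<bar>m\<bar>" y 1] by auto
      then show "j = j' \<and> i = i'" using m by simp
    qed
    show "(\<lambda>(j, i). cyl_box x y i j) ` R = {C \<in> boxes x y D. T C = Suc l}"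
    proof (intro subset_antisym subsetI)
      fix C assume "C \<in> (\<lambda>(j, i). cyl_box x y i j) ` R"
      then obtain i j where C: "C = cyl_box x y i j" "L l j \<le> i" "i < L (Suc l) j"
        by (auto simp: R_def)
      then have "(i, j) \<in> plane_boxes D"
        using low[of j l] high[of "Suc l" j] by (simp add: plane_boxes_iff)
      then show "C \<in> {C \<in> boxes x y D. T C = Suc l}"
        using C entry by (simp add: boxes_mem_iff)
    next
      fix C assume C: "C \<in> {C \<in> boxes x y D. T C = Suc l}"
      then obtain i j where ij: "C = cyl_box x y i j" "j \<in> {0..<y}" "\<alpha> j \<le> i" "i < \<beta> j"
        by (auto elim: boxes_cases)
      then have "(j, i) \<in> R" using C entry[of i j] by (simp add: R_def plane_boxes_iff)
      then show "C \<in> (\<lambda>(j, i). cyl_box x y i j) ` R" using ij(1) by force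
    qed
  qed
  then have "card {C \<in> boxes x y D. T C = Suc l} = card R" by (simp add: bij_betw_same_card)
  also have "card R = (\<Sum>j\<in>{0..<y}. nat (L (Suc l) j - L l j))"
    by (simp add: R_def)
  finally show ?thesis
    using L by (simp add: sum_subtractf[symmetric] strip_chain_def)
qed

text \<open>
  Weak increase along rows makes the boxes with entry at most \<open>l\<close> an initial segment of each row,
  which defines \<open>L l\<close>. Strict increase upwards gives \<open>L (Suc l) j \<le> L l (j - 1)\<close>: below the last box
  of row \<open>j\<close> with entry at most \<open>Suc l\<close> there is either the inner loop or an entry at most \<open>l\<close>.
\<close>

lemma strip_chain_of_tableau:
  assumes T: "T \<in> cylindric_ssyt x y D" and bounded: "\<And>C. C \<in> boxes x y D \<Longrightarrow> T C \<le> n"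
  obtains L where "strip_chain x y \<alpha> \<beta> n L"
    and "\<And>i j l. (i, j) \<in> plane_boxes D \<Longrightarrow> T (cyl_box x y i j) \<le> l \<longleftrightarrow> i < L l j"
proof -
  have row: "T (cyl_box x y i j) \<le> T (cyl_box x y (i + 1) j)"
    if "(i, j) \<in> plane_boxes D" "(i + 1, j) \<in> plane_boxes D" for i j
    using T that by (auto simp: cylindric_ssyt_def)
  have col: "T (cyl_box x y i j) < T (cyl_box x y i (j + 1))"
    if "(i, j) \<in> plane_boxes D" "(i, j + 1) \<in> plane_boxes D" for i j
    using T that by (auto simp: cylindric_ssyt_def)
  have pos: "T (cyl_box x y i j) > 0" if "(i, j) \<in> plane_boxes D" for i j
  proof -
    have "T \<in> boxes x y D \<rightarrow>\<^sub>E {1..}" using T by (simp add: cylindric_ssyt_def)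
    then have "T (cyl_box x y i j) \<in> {1..}"
      by (rule PiE_mem) (simp add: boxes_mem_iff that)
    then show ?thesis by simp
  qed
  define th where "th = (\<lambda>l j m. \<alpha> j \<le> m \<and> m \<le> \<beta> j \<and>
      (\<forall>i. \<alpha> j \<le> i \<longrightarrow> i < \<beta> j \<longrightarrow> (T (cyl_box x y i j) \<le> l \<longleftrightarrow> i < m)))"
  have ex1: "\<exists>!m. th l j m" for l j
    unfolding th_def
  proof (rule ex1_threshold[OF inner_le_outer])
    fix c assume "\<alpha> j \<le> c" "c + 1 < \<beta> j" "T (cyl_box x y (c + 1) j) \<le> l"
    then show "T (cyl_box x y c j) \<le> l" using row[of c j] by (simp add: plane_boxes_iff)
  qed
  define L where "L = (\<lambda>l j. THE m. th l j m)"
  have L: "th l j (L l j)" for l j unfolding L_def by (rule theI'[OF ex1])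
  have L_eqI: "L l j = m" if "th l j m" for l j m using ex1 L that by blast
  have bounds: "\<alpha> j \<le> L l j" "L l j \<le> \<beta> j" for l j using L[of l j] by (auto simp: th_def)
  have below: "T (cyl_box x y i j) \<le> l \<longleftrightarrow> i < L l j" if "(i, j) \<in> plane_boxes D" for i j l
    using L[of l j] that by (auto simp: th_def plane_boxes_iff)
  have "strip_chain x y \<alpha> \<beta> n L"
    unfolding strip_chain_def
  proof (intro conjI allI impI ext)
    fix l
    show "quasi_periodic x y (L l)"
      unfolding quasi_periodic_def
    proof (intro allI L_eqI)
      fix j
      have "cyl_box x y i (j - y) = cyl_box x y (i - x) j" for i
        unfolding cyl_box_eq_iff by (intro exI[of _ "-1"]) simp
      moreover have "\<alpha> (j - y) = \<alpha> j + x" "\<beta> (j - y) = \<beta> j + x"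
        using qp_inner qp_outer by (auto simp: quasi_periodic_def)
      ultimately show "th l (j - y) (L l j + x)"
        using L[of l j] by (auto simp: th_def)
    qed
  next
    fix j
    have "T (cyl_box x y i j) > 0" if "\<alpha> j \<le> i" "i < \<beta> j" for i
      using pos that by (simp add: plane_boxes_iff)
    then show "L 0 j = \<alpha> j"
      by (intro L_eqI) (auto simp: th_def inner_le_outer)
  next
    fix l j assume "n \<le> l"
    then have "T (cyl_box x y i j) \<le> l" if "\<alpha> j \<le> i" "i < \<beta> j" for i
      using bounded[of "cyl_box x y i j"] that by (simp add: boxes_mem_iff plane_boxes_iff)
    then show "L l j = \<beta> j"
      by (intro L_eqI) (auto simp: th_def inner_le_outer)
  next
    fix l j
    show "L l j \<le> L (Suc l) j"
    proof (rule ccontr)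
      assume "\<not> L l j \<le> L (Suc l) j"
      moreover from this have "(L (Suc l) j, j) \<in> plane_boxes D"
        using bounds(1)[of j "Suc l"] bounds(2)[of l j] by (auto simp: plane_boxes_iff)
      ultimately show False
        using below[of "L (Suc l) j" j l] below[of "L (Suc l) j" j "Suc l"] by simp
    qed
    show "L (Suc l) j \<le> L l (j - 1)"
    proof (rule ccontr)
      assume neg: "\<not> L (Suc l) j \<le> L l (j - 1)"
      \<comment> \<open>The last box of row \<open>j\<close> with entry at most \<open>Suc l\<close>; the failing inequality makes it and
        the box below it belong to the diagram.\<close>
      define c where "c = L (Suc l) j - 1"
      have "\<alpha> j \<le> \<alpha> (j - 1)" "\<beta> j \<le> \<beta> (j - 1)"
        using antimonoD[OF anti_inner, of "j - 1" j] antimonoD[OF anti_outer, of "j - 1" j] by auto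
      then have "(c, j) \<in> plane_boxes D" "(c, j - 1) \<in> plane_boxes D"
        using neg bounds(1)[of "j - 1" l] bounds(1)[of j "Suc l"] bounds(2)[of "Suc l" j] by (auto simp: plane_boxes_iff c_def)
      then show False
        using col[of c "j - 1"] below[of c j "Suc l"] below[of c "j - 1" l] neg
        by (auto simp: c_def)
    qed
  qed
  then show thesis using that below by blast
qed

text \<open>
  The entry of a box is the first \<open>l\<close> whose profile passes it. As profiles are quasi-periodic, it
  does not matter which representative in the plane is tested, so the test can be put on the class.
\<close>

lemma tableau_of_strip_chain:
  assumes L: "strip_chain x y \<alpha> \<beta> n L"
  obtains T where "T \<in> cylindric_ssyt x y D" and "\<And>C. C \<in> boxes x y D \<Longrightarrow> T C \<in> {1..n}"
    and "\<And>i j l. (i, j) \<in> plane_boxes D \<Longrightarrow> T (cyl_box x y i j) \<le> l \<longleftrightarrow> i < L l j"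
proof -
  define T where "T = restrict (\<lambda>C. LEAST l. \<exists>(i, j) \<in> C. i < L l j) (boxes x y D)"
  have qp: "quasi_periodic x y (L l)" for l using L by (simp add: strip_chain_def)
  have T: "T (cyl_box x y i j) = (LEAST l. i < L l j)" if "(i, j) \<in> plane_boxes D" for i j
  proof -
    have "(\<exists>(a, b) \<in> cyl_box x y i j. a < L l b) \<longleftrightarrow> i < L l j" for l
      by (auto simp: cyl_box_def cyl_rel_def quasi_periodic_shift[OF qp])
        (metis diff_zero mult_zero_left add_0_right)
    then show ?thesis using that by (simp add: T_def boxes_mem_iff)
  qed
  have top: "i < L n j" if "(i, j) \<in> plane_boxes D" for i j
    using L that by (simp add: strip_chain_def plane_boxes_iff)
  have below: "T (cyl_box x y i j) \<le> l \<longleftrightarrow> i < L l j" if box: "(i, j) \<in> plane_boxes D" for i j l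
  proof
    assume "T (cyl_box x y i j) \<le> l"
    moreover have "i < L (LEAST l. i < L l j) j" using top[OF box] by (rule LeastI)
    ultimately show "i < L l j"
      using strip_chain_mono[OF L, of "LEAST l. i < L l j" l j] T[OF box] by simp
  qed (simp add: T[OF box] Least_le)
  have pos: "T (cyl_box x y i j) \<noteq> 0" if "(i, j) \<in> plane_boxes D" for i j
    using below[OF that, of 0] L that by (auto simp: strip_chain_def plane_boxes_iff)
  have range: "T C \<in> {1..n}" if "C \<in> boxes x y D" for C
    using that below[THEN iffD2, OF _ top] pos by (auto simp: boxes_eq Suc_le_eq)
  have "T \<in> cylindric_ssyt x y D"
    unfolding cylindric_ssyt_def
  proof (intro CollectI conjI allI impI)
    show "T \<in> boxes x y D \<rightarrow>\<^sub>E {1..}"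
      using range by (auto simp: PiE_iff T_def)
  next
    fix i j assume "(i, j) \<in> plane_boxes D \<and> (i + 1, j) \<in> plane_boxes D"
    then show "T (cyl_box x y i j) \<le> T (cyl_box x y (i + 1) j)"
      using below[of i j] below[of "i + 1" j "T (cyl_box x y (i + 1) j)"] by simp
  next
    fix i j assume box: "(i, j) \<in> plane_boxes D \<and> (i, j + 1) \<in> plane_boxes D"
    then obtain l where l: "T (cyl_box x y i (j + 1)) = Suc l"
      using pos[of i "j + 1"] by (auto simp: gr0_conv_Suc)
    have "i < L (Suc l) (j + 1)" using below[of i "j + 1" "Suc l"] box l by simp
    also have "\<dots> \<le> L l (j + 1 - 1)" using L unfolding strip_chain_def by blast
    finally have "T (cyl_box x y i j) \<le> l" using below box by simp
    then show "T (cyl_box x y i j) < T (cyl_box x y i (j + 1))" using l by simp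
  qed
  then show thesis using that range below by blast
qed

text \<open>
  The partial sums of \<open>\<nu>\<close> are shifted by the size of the inner profile, so that they are the sizes of
  the chain themselves.
\<close>

lemma card_CSSYT_pos_iff:
  "card (CSSYT x y D \<nu>) > 0 \<longleftrightarrow>
   chain_sizes x y \<alpha> \<beta> (length \<nu>) (\<lambda>i. (\<Sum>j\<in>{0..<y}. \<alpha> j) + int (sum_list (take i \<nu>)))"
proof -
  let ?n = "length \<nu>"
  define s where "s = (\<lambda>i. (\<Sum>j\<in>{0..<y}. \<alpha> j) + int (sum_list (take i \<nu>)))"
  have s_Suc: "s (Suc i) = s i + int (\<nu> ! i)" if "i < ?n" for i
    using that by (simp add: s_def take_Suc_conv_app_nth)
  have "CSSYT x y D \<nu> \<noteq> {} \<longleftrightarrow> chain_sizes x y \<alpha> \<beta> ?n s"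
  proof
    assume "CSSYT x y D \<nu> \<noteq> {}"
    then obtain T where T: "T \<in> cylindric_ssyt x y D" "\<And>C. C \<in> boxes x y D \<Longrightarrow> T C \<in> {1..?n}"
      and w: "\<And>i. i \<in> {1..?n} \<Longrightarrow> card {C \<in> boxes x y D. T C = i} = \<nu> ! (i - 1)"
      by (auto simp: CSSYT_def)
    have "T C \<le> ?n" if "C \<in> boxes x y D" for C using T(2)[OF that] by simp
    then obtain L where L: "strip_chain x y \<alpha> \<beta> ?n L"
      and below: "\<And>i j l. (i, j) \<in> plane_boxes D \<Longrightarrow> T (cyl_box x y i j) \<le> l \<longleftrightarrow> i < L l j"
      using strip_chain_of_tableau[OF T(1)] by blast
    have upto: "s i = (\<Sum>j\<in>{0..<y}. L i j)" if "i \<le> ?n" for i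
      using that
    proof (induction i)
      case 0
      then show ?case using L by (simp add: s_def strip_chain_def)
    next
      case (Suc i)
      then show ?case
        using card_entries[OF L below, of i] w[of "Suc i"] s_Suc[of i] by simp
    qed
    have "s i = (\<Sum>j\<in>{0..<y}. L i j)" for i
    proof (cases "i \<le> ?n")
      case False
      then have "s i = s ?n" "L i = L ?n" using L by (auto simp: s_def strip_chain_def)
      then show ?thesis using upto[of ?n] by simp
    qed (rule upto)
    then show "chain_sizes x y \<alpha> \<beta> ?n s" using L unfolding chain_sizes_def by blast
  next
    assume "chain_sizes x y \<alpha> \<beta> ?n s"
    then obtain L where L: "strip_chain x y \<alpha> \<beta> ?n L" and s: "s = (\<lambda>i. \<Sum>j\<in>{0..<y}. L i j)"
      unfolding chain_sizes_def by blast
    obtain T where T: "T \<in> cylindric_ssyt x y D" "\<And>C. C \<in> boxes x y D \<Longrightarrow> T C \<in> {1..?n}"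
      and below: "\<And>i j l. (i, j) \<in> plane_boxes D \<Longrightarrow> T (cyl_box x y i j) \<le> l \<longleftrightarrow> i < L l j"
      by (rule tableau_of_strip_chain[OF L]) (rule that)
    have "card {C \<in> boxes x y D. T C = i} = \<nu> ! (i - 1)" if i: "i \<in> {1..?n}" for i
    proof -
      obtain l where l: "i = Suc l" "l < ?n" using i by (cases i) auto
      have "int (card {C \<in> boxes x y D. T C = Suc l}) = s (Suc l) - s l"
        using card_entries[OF L below, of l] by (simp add: s)
      then show ?thesis using s_Suc[OF l(2)] l(1) by simp
    qed
    then have "T \<in> CSSYT x y D \<nu>" using T unfolding CSSYT_def by blast
    then show "CSSYT x y D \<nu> \<noteq> {}" by blast
  qed
  then show ?thesis using finite_CSSYT by (simp add: card_gt_0_iff s_def)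
qed

end

section \<open>Loops as row profiles\<close>

text \<open>
  In column \<open>c j\<close> the loop steps down from height \<open>j + 1\<close> to \<open>j\<close>. The remaining conditions say that
  the loop stays weakly left of this step while it is above it, and weakly right of it afterwards.
\<close>

definition loop_profile :: "(int \<times> int) set \<Rightarrow> (int \<Rightarrow> int) \<Rightarrow> bool" where
  "loop_profile B c \<longleftrightarrow>
     (\<forall>j. (c j, j) \<in> B \<and> (c j, j + 1) \<in> B \<and>
          (\<forall>(a, b) \<in> B. (b \<le> j \<longrightarrow> c j \<le> a) \<and> (j < b \<longrightarrow> a \<le> c j)))"

lemma loop_profileD:
  assumes "loop_profile B c"
  shows "(c j, j) \<in> B" "(c j, j + 1) \<in> B"
    and "(a, b) \<in> B \<Longrightarrow> b \<le> j \<Longrightarrow> c j \<le> a" "(a, b) \<in> B \<Longrightarrow> j < b \<Longrightarrow> a \<le> c j"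
  using assms by (auto simp: loop_profile_def)

lemma loop_profile_antimono:
  assumes "loop_profile B c"
  shows "antimono c"
proof (rule antimonoI)
  fix j j' :: int assume "j \<le> j'"
  then show "c j' \<le> c j" using loop_profileD(2)[OF assms, of j'] loop_profileD(4)[OF assms] by simp
qed

text \<open>
  The vertices added by stretching lie on a horizontal segment between the images of two vertices
  of the same row, so they satisfy the inequalities that hold for these images.
\<close>

lemma loop_profile_stretch:
  assumes c: "loop_profile B c"
  shows "loop_profile (stretch_loop k B) (\<lambda>j. int k * c j)"
  unfolding loop_profile_def
proof (intro allI conjI ballI, safe)
  fix j
  show "(int k * c j, j) \<in> stretch_loop k B"
    using loop_profileD(1)[OF c, of j] by (force simp: stretch_loop_def)
  show "(int k * c j, j + 1) \<in> stretch_loop k B"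
    using loop_profileD(2)[OF c, of j] by (force simp: stretch_loop_def)
next
  fix j a b assume ab: "(a, b) \<in> stretch_loop k B"
  then obtain a' r where a': "a = int k * a' + r" "(a', b) \<in> B"
    "r = 0 \<or> (a' + 1, b) \<in> B \<and> 0 \<le> r \<and> r \<le> int k"
    by (auto simp: stretch_loop_def)
  {
    assume "b \<le> j"
    then have "int k * c j \<le> int k * a'"
      using loop_profileD(3)[OF c a'(2)] by (simp add: mult_left_mono)
    then show "int k * c j \<le> a" using a' by auto
  next
    assume "j < b"
    show "a \<le> int k * c j"
    proof (cases "r = 0")
      case True
      then show ?thesis
        using loop_profileD(4)[OF c a'(2) \<open>j < b\<close>] a'(1) by (simp add: mult_left_mono)
    next
      case False
      then have "int k * (a' + 1) \<le> int k * c j"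
        using loop_profileD(4)[OF c _ \<open>j < b\<close>] a'(3) by (intro mult_left_mono) auto
      then show ?thesis using False a' by (auto simp: algebra_simps)
    qed
  }
qed

text \<open>
  The translation moves a vertex by \<open>y \<ge> 1\<close> rows, so a loop reaches every height from above and
  from below; as it descends one row at a time, it crosses each row in exactly one step.
\<close>

lemma ex_loop_profile:
  assumes loop: "boundary_loop x y B" and y: "y \<ge> 1"
  obtains c where "loop_profile B c" "quasi_periodic x y c"
proof -
  obtain p where p: "lattice_path p" and B: "B = range p"
    and inv: "(\<lambda>(a, b). (a + x, b - y)) ` B = B"
    using loop by (auto simp: boundary_loop_def)
  have path_step: "p (t + 1) = (fst (p t) + 1, snd (p t)) \<or> p (t + 1) = (fst (p t), snd (p t) - 1)" for t
    using p by (simp add: lattice_path_def)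
  have mono: "fst (p t) \<le> fst (p t') \<and> snd (p t') \<le> snd (p t)" if "t \<le> t'" for t t'
    using that
  proof (induction t' rule: int_ge_induct)
    case (step t')
    then show ?case using path_step[of t'] by auto
  qed simp
  have down: "(a + x, b - y) \<in> B" if "(a, b) \<in> B" for a b
    using inv that by force
  have up: "(a - x, b + y) \<in> B" if "(a, b) \<in> B" for a b
  proof -
    have "(a, b) \<in> (\<lambda>(a, b). (a + x, b - y)) ` B" using that by (simp only: inv)
    then obtain a' b' where "(a', b') \<in> B" "a = a' + x" "b = b' - y" by auto
    then show ?thesis by simp
  qed
  have down': "(fst (p 0) + int m * x, snd (p 0) - int m * y) \<in> B" for m
  proof (induction m)
    case 0
    then show ?case by (simp add: B)
  next
    case (Suc m)
    from down[OF this] show ?case by (simp add: algebra_simps)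
  qed
  have up': "(fst (p 0) - int m * x, snd (p 0) + int m * y) \<in> B" for m
  proof (induction m)
    case 0
    then show ?case by (simp add: B)
  next
    case (Suc m)
    from up[OF this] show ?case by (simp add: algebra_simps)
  qed
  have ex: "\<exists>t. snd (p t) = j + 1 \<and> p (t + 1) = (fst (p t), j)" for j
  proof -
    define m where "m = nat (\<bar>snd (p 0)\<bar> + \<bar>j\<bar> + 1)"
    have "int m \<le> int m * y" using y by (simp add: mult_le_cancel_left1)
    then have m: "\<bar>snd (p 0)\<bar> + \<bar>j\<bar> + 1 \<le> int m * y" by (simp add: m_def)
    obtain t0 where t0: "snd (p t0) > j"
    proof -
      obtain t where "p t = (fst (p 0) - int m * x, snd (p 0) + int m * y)"
        using up'[of m] unfolding B by (metis imageE)
      then have "snd (p t) > j" using m by simp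
      then show thesis by (rule that)
    qed
    obtain t1 where t1: "snd (p t1) \<le> j"
    proof -
      obtain t where "p t = (fst (p 0) + int m * x, snd (p 0) - int m * y)"
        using down'[of m] unfolding B by (metis imageE)
      then have "snd (p t) \<le> j" using m by simp
      then show thesis by (rule that)
    qed
    have "t0 \<le> t1" using mono[of t1 t0] t0 t1 by linarith
    have "\<exists>t. snd (p t) > j \<and> snd (p (t + 1)) \<le> j"
    proof (rule ccontr)
      assume none: "\<nexists>t. snd (p t) > j \<and> snd (p (t + 1)) \<le> j"
      have "snd (p t1) > j"
        using \<open>t0 \<le> t1\<close>
      proof (induction t1 rule: int_ge_induct)
        case base
        then show ?case by (rule t0)
      next
        case (step t)
        then show ?case using none by force
      qed
      then show False using t1 by simp
    qed
    then obtain t where "snd (p t) > j" "snd (p (t + 1)) \<le> j" by blast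
    then show ?thesis using path_step[of t] by (intro exI[of _ t]) auto
  qed
  then obtain \<tau> where \<tau>: "\<And>j. snd (p (\<tau> j)) = j + 1" "\<And>j. p (\<tau> j + 1) = (fst (p (\<tau> j)), j)"
    by metis
  define c where "c = (\<lambda>j. fst (p (\<tau> j)))"
  have c: "loop_profile B c"
    unfolding loop_profile_def
  proof (intro allI conjI ballI, safe)
    fix j
    have "p (\<tau> j + 1) = (c j, j)" "p (\<tau> j) = (c j, j + 1)"
      using \<tau> by (auto simp: c_def prod_eq_iff)
    then show "(c j, j) \<in> B" "(c j, j + 1) \<in> B" unfolding B by (metis rangeI)+
  next
    fix j a b assume "(a, b) \<in> B"
    then obtain t where t: "p t = (a, b)" unfolding B by force
    { assume "b \<le> j"
      then have "\<tau> j \<le> t" using mono[of t "\<tau> j"] \<tau>(1)[of j] t by force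
      then show "c j \<le> a" using mono t by (force simp: c_def)
    next
      assume "j < b"
      then have "t \<le> \<tau> j" using mono[of "\<tau> j + 1" t] \<tau>(2)[of j] t by force
      then show "a \<le> c j" using mono t by (force simp: c_def) }
  qed
  have "c (j - y) = c j + x" for j
  proof (rule antisym)
    show "c (j - y) \<le> c j + x"
      using loop_profileD(3)[OF c down[OF loop_profileD(1)[OF c]]] by simp
    show "c j + x \<le> c (j - y)"
      using loop_profileD(4)[OF c down[OF loop_profileD(2)[OF c]]] by simp
  qed
  then show thesis using that c by (simp add: quasi_periodic_def)
qed

text \<open>
  Among the vertices of height at most \<open>j\<close> the leftmost one is at \<open>\<alpha> j\<close>, and among those of height
  at least \<open>j + 1\<close> the rightmost one is at \<open>\<beta> j\<close>.
\<close>

lemma plane_boxes_profile: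
  assumes \<alpha>: "loop_profile B\<^sub>I \<alpha>" and \<beta>: "loop_profile B\<^sub>O \<beta>"
  shows "(i, j) \<in> plane_boxes (B\<^sub>I, B\<^sub>O) \<longleftrightarrow> \<alpha> j \<le> i \<and> i < \<beta> j"
proof -
  have "(\<exists>(a, b) \<in> B\<^sub>I. a \<le> i \<and> b \<le> j) \<longleftrightarrow> \<alpha> j \<le> i"
    using loop_profileD(1)[OF \<alpha>, of j] loop_profileD(3)[OF \<alpha>, of _ _ j] by force
  moreover have "(\<exists>(a, b) \<in> B\<^sub>O. i + 1 \<le> a \<and> j + 1 \<le> b) \<longleftrightarrow> i + 1 \<le> \<beta> j"
    using loop_profileD(2)[OF \<beta>, of j] loop_profileD(4)[OF \<beta>, of _ _ j] by force
  ultimately show ?thesis by (simp add: plane_boxes_def add1_zle_eq)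
qed

theorem theorem30:
  fixes x y :: int and D :: diagram and \<nu> :: "nat list" and k :: nat
  assumes "x \<ge> 1" and "y \<ge> 1"
    and "cylindric_diagram x y D"
    and "k \<ge> 1"
  shows "card (CSSYT (int k * x) y (stretch_diagram k D) (map (\<lambda>m. k * m) \<nu>)) > 0 \<longleftrightarrow>
         card (CSSYT x y D \<nu>) > 0"
proof -
  obtain B\<^sub>I B\<^sub>O where D: "D = (B\<^sub>I, B\<^sub>O)" by (cases D)
  have loops: "boundary_loop x y B\<^sub>I" "boundary_loop x y B\<^sub>O" and wlb: "weakly_left_below B\<^sub>I B\<^sub>O"
    using assms(3) by (auto simp: D cylindric_diagram_def)
  obtain \<alpha> where \<alpha>: "loop_profile B\<^sub>I \<alpha>" "quasi_periodic x y \<alpha>"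
    using ex_loop_profile[OF loops(1) \<open>y \<ge> 1\<close>] .
  obtain \<beta> where \<beta>: "loop_profile B\<^sub>O \<beta>" "quasi_periodic x y \<beta>"
    using ex_loop_profile[OF loops(2) \<open>y \<ge> 1\<close>] .
  have le: "\<alpha> j \<le> \<beta> j" for j
  proof -
    obtain a b where "(a, b) \<in> B\<^sub>O" "\<alpha> j \<le> a" "j + 1 \<le> b"
      using wlb loop_profileD(2)[OF \<alpha>(1), of j] by (force simp: weakly_left_below_def)
    then show ?thesis using loop_profileD(4)[OF \<beta>(1), of a b j] by simp
  qed
  interpret S: cylindric_shape x y D \<alpha> \<beta>
    using \<open>y \<ge> 1\<close> \<alpha> \<beta> le plane_boxes_profile loop_profile_antimono
    by unfold_locales (auto simp: D)
  define \<alpha>' \<beta>' where "\<alpha>' = (\<lambda>j. int k * \<alpha> j)" and "\<beta>' = (\<lambda>j. int k * \<beta> j)"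
  have stretched: "loop_profile (stretch_loop k B\<^sub>I) \<alpha>'" "loop_profile (stretch_loop k B\<^sub>O) \<beta>'"
    unfolding \<alpha>'_def \<beta>'_def using \<alpha>(1) \<beta>(1) by (simp_all add: loop_profile_stretch)
  interpret S': cylindric_shape "int k * x" y "stretch_diagram k D" \<alpha>' \<beta>'
  proof unfold_locales
    show "quasi_periodic (int k * x) y \<alpha>'" "quasi_periodic (int k * x) y \<beta>'"
      using \<alpha>(2) \<beta>(2) by (simp_all add: \<alpha>'_def \<beta>'_def quasi_periodic_def distrib_left)
    show "antimono \<alpha>'" "antimono \<beta>'" using stretched by (simp_all add: loop_profile_antimono)
    show "\<alpha>' j \<le> \<beta>' j" for j using le by (simp add: \<alpha>'_def \<beta>'_def mult_left_mono)
    show "(i, j) \<in> plane_boxes (stretch_diagram k D) \<longleftrightarrow> \<alpha>' j \<le> i \<and> i < \<beta>' j" for i j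
      using plane_boxes_profile[OF stretched] by (simp add: D stretch_diagram_def)
  qed fact
  have "int (sum_list (take i (map (\<lambda>m. k * m) \<nu>))) = int k * int (sum_list (take i \<nu>))" for i
    by (simp add: take_map sum_list_const_mult)
  then have "card (CSSYT (int k * x) y (stretch_diagram k D) (map (\<lambda>m. k * m) \<nu>)) > 0 \<longleftrightarrow>
      chain_sizes (int k * x) y \<alpha>' \<beta>' (length \<nu>)
        (\<lambda>i. int k * ((\<Sum>j\<in>{0..<y}. \<alpha> j) + int (sum_list (take i \<nu>))))"
    unfolding S'.card_CSSYT_pos_iff by (simp add: \<alpha>'_def sum_distrib_left distrib_left)
  also have "\<dots> \<longleftrightarrow> chain_sizes x y \<alpha> \<beta> (length \<nu>)
      (\<lambda>i. (\<Sum>j\<in>{0..<y}. \<alpha> j) + int (sum_list (take i \<nu>)))"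
    unfolding \<alpha>'_def \<beta>'_def
    using \<open>k \<ge> 1\<close> \<open>y \<ge> 1\<close> le S.anti_inner S.anti_outer
    by (intro chain_sizes_scale[OF \<alpha>(2) \<beta>(2)]) auto
  also have "\<dots> \<longleftrightarrow> card (CSSYT x y D \<nu>) > 0" by (simp add: S.card_CSSYT_pos_iff)
  finally show ?thesis .
qed

end
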